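(* Let $X,Y$ be sets, $0\in X$ distinguished, $\mathcal{A}=(R,Q,E,\rho,\xi,\rhd)$ an approximation algorithm of sort $X^\ast,X,Y$ with set of states $S=R\times(Y\cup\{\Box\})$, $\Omega$ a set and $\pi:S\to\Omega$ a function, and suppose $G=(\Omega,A\cup A')$ is a control flow graph for $\mathcal{A}$ with respect to $\pi$. Let $\Omega_I:=\{\pi(\langle\rho(u)\mid\Box\rangle): u\in X^\ast\}$ and $\Omega_E:=\pi(E)$. Let $\Sigma:=\{\star\}\cup(\{\mathsf{b},\mathsf{t}\}\times\mathbb{N}\times\Omega)$ and define the directed graph $G_\omega:=(\Sigma,B\cup B')$ by: (1) if $pAq$ then $(\mathsf{b},n,p)\,B\,(\mathsf{b},n,q)$ for all $n$; (2) if $pA'q$ then, for all $n$: $(\mathsf{b},n,p)\,B'\,(\mathsf{t},n,p)$; $(\mathsf{t},n,p)\,B'\,(\mathsf{b},n,q)$; $(\mathsf{t},n,p)\,B\,(\mathsf{b},n+1,u)$ for all $u\in\Omega_I$; and $(\mathsf{b},n+1,u)\,B\,(\mathsf{b},n,q)$ for all $u\in\Omega_E$; (3) $(\mathsf{b},0,u)\,B\,\star$ for all $u\in\Omega_E$. Define $\pi_\omega$ on states of $\mathcal{A}_\omega$ by $\pi_\omega\langle\sigma::r,a\mid o_1,o_2\rangle:=(\mathsf{t},|\sigma|,\pi\langle r\mid o_2\rangle)$ if $o_1\in\mathbb{N}$ and $o_2=\Box$, $:=(\mathsf{b},|\sigma|,\pi\langle r\mid o_2\rangle)$ otherwise, and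 $\pi_\omega\langle[\,],a\mid o_1,o_2\rangle:=\star$. Then $G_\omega$ is a control flow graph for $\mathcal{A}_\omega$ with respect to $\pi_\omega$.
   Context: Notation: $Z^\ast$ finite sequences over $Z$, $[\,]$ empty sequence, $|a|$ length, $::$ extension/concatenation; $\mathbf{0}$ the constant sequence $0,0,\dots$. Approximation algorithm of sort $U,X,Y$: tuple $(R,Q,E,\rho,\xi,\rhd)$; states $\langle r\mid o\rangle$ with $r\in R$, $o\in Y\cup\{\Box\}$; $Q\subseteq\{\langle r\mid\Box\rangle\}$ query states; $E\subseteq\{\langle r\mid y\rangle:y\in Y\}$ end states, $Q\cap E=\emptyset$; $\rho:U\to R$; $\xi:R\to X$; $\rhd$ partial function on states with: if $\rhd(\langle r\mid o\rangle)=\langle r'\mid y\rangle$, $y\in Y$, then $o=y$ and $\xi(r)=\xi(r')$. A run on oracle $f:X\to Y$ is a finite sequence $s_0,\dots,s_m$, $s_i\notin E$ for $i<m$, with $s_{i+1}=\langle r\mid f(\xi(r))\rangle$ if $s_i=\langle r\mid\Box\rangle\in Q$ and $s_{i+1}=\rhd(s_i)$ if $s_i\notin Q$. Control flow graph: a directed graph $(\Omega,A\cup A')$ (two edge sets) is a control flow graph for $\mathcal{A}$ w.r.t. $\pi:S\to\Omega$ if for every run $s_0,\dots,s_m$ on any oracle with $s_0=\langle\rho(u)\mid\Box\rangle$ for some $u$, we have $(\pi(s_i),\pi(s_{i+1}))\in A$ whenever $i<m$ and $s_i\notin Q$, and $(\pi(s_i),\pi(s_{i+1}))\in A'$ whenever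 $i<m$ and $s_i\in Q$. For $\mathcal{A}_\omega$ (which has two kinds of query states $Q_1,Q_2$), $(\Sigma,B\cup B')$ is a control flow graph w.r.t. $\pi_\omega$ if for every run $s_0,\dots,s_m$ of $\mathcal{A}_\omega$ from its initial state on any oracles $\phi_1,\phi_2$, $(\pi_\omega(s_i),\pi_\omega(s_{i+1}))\in B$ when $s_i\notin Q_1\cup Q_2$ and $\in B'$ when $s_i\in Q_1\cup Q_2$. Construction of $\mathcal{A}_\omega$: states $\langle\sigma,a\mid o_1,o_2\rangle$, $\sigma\in R^\ast$, $a\in X^\ast$, $o_1\in\mathbb{N}\cup\{\Box\}$, $o_2\in Y\cup\{\Box\}$; initial state $\langle[\rho([\,])],[\,]\mid\Box,\Box\rangle$; $Q_1$: $\langle\sigma::r,[\,]\mid\Box,\Box\rangle$ with $\langle r\mid\Box\rangle\in Q$; $Q_2$: $\langle\sigma,[\,]\mid n,\Box\rangle$ with $n\in\mathbb{N}$, $n<|\sigma|$; end states $E_\omega$: $\langle[\,],a\mid n,y\rangle$, $n\in\mathbb{N},y\in Y$; $\xi^\ast$ applies $\xi$ componentwise, $\xi_\omega(\sigma,a):=\xi^\ast(\sigma)::a::\mathbf{0}$. Transitions $\rhd_\omega$: (a) $\langle\sigma,[\,]\mid n,\Box\rangle\rhd_\omega\langle\sigma::\rho(\xi^\ast(\sigma)),[\,]\mid\Box,\Box\rangle$; (b) $\langle\sigma::r,a\mid n,y\rangle\rhd_\omega\langle\sigma,\xi(r)::a\mid n,y\rangle$ if $\langle r\mid y\rangle\in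 E$; (c) otherwise (i) $\langle\sigma::r,[\,]\mid\Box,\Box\rangle\rhd_\omega\langle\sigma::r',[\,]\mid\Box,\Box\rangle$ if $\rhd\langle r\mid\Box\rangle=\langle r'\mid\Box\rangle$, (ii) $\langle\sigma::r,a\mid n,y\rangle\rhd_\omega\langle\sigma::r',[\,]\mid\Box,\Box\rangle$ if $\rhd\langle r\mid y\rangle=\langle r'\mid\Box\rangle$, (iii) $\langle\sigma::r,a\mid n,y\rangle\rhd_\omega\langle\sigma::r',a\mid n,y\rangle$ if $\rhd\langle r\mid y\rangle=\langle r'\mid y\rangle$. Oracles $\phi_1:X^{\mathbb{N}}\to\mathbb{N}$, $\phi_2:X^{\mathbb{N}}\to Y$: a state in $Q_1$ moves to $\langle\sigma,a\mid\phi_1(\xi_\omega(\sigma,a)),\Box\rangle$, a state $\langle\sigma,a\mid n,\Box\rangle\in Q_2$ moves to $\langle\sigma,a\mid n,\phi_2(\xi_\omega(\sigma,a))\rangle$, other states move by $\rhd_\omega$; runs do not pass through $E_\omega$ before their last element. *)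

theory Defs
  imports Main
begin

text \<open>
  The sets \<open>U\<close>, \<open>X\<close>, \<open>Y\<close>, \<open>R\<close> and \<open>\<Omega>\<close> are types. The symbol \<open>\<box>\<close> is \<^const>\<open>None\<close>, and finite sequences
  are lists. As in the usual notation \<open>\<sigma>::r\<close>, sequences are extended on the right.
\<close>

datatype ('r, 'y) state = State 'r "'y option"

record ('u, 'x, 'y, 'r) approx_alg =
  query_states :: "('r, 'y) state set"
  end_states :: "('r, 'y) state set"
  rho :: "'u \<Rightarrow> 'r"
  xi :: "'r \<Rightarrow> 'x"
  trans_fun :: "('r, 'y) state \<Rightarrow> ('r, 'y) state option"

definition approximation_algorithm :: "('u, 'x, 'y, 'r) approx_alg \<Rightarrow> bool" where
  "approximation_algorithm \<A> \<longleftrightarrow>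
     query_states \<A> \<subseteq> {State r None | r. True} \<and>
     end_states \<A> \<subseteq> {State r (Some y) | r y. True} \<and>
     query_states \<A> \<inter> end_states \<A> = {} \<and>
     (\<forall>r ob r' y. trans_fun \<A> (State r ob) = Some (State r' (Some y))
        \<longrightarrow> ob = Some y \<and> xi \<A> r = xi \<A> r')"

inductive move :: "('u, 'x, 'y, 'r) approx_alg \<Rightarrow> ('x \<Rightarrow> 'y) \<Rightarrow>
    ('r, 'y) state \<Rightarrow> ('r, 'y) state \<Rightarrow> bool"
  for \<A> f where
  query: "State r None \<in> query_states \<A>
    \<Longrightarrow> move \<A> f (State r None) (State r (Some (f (xi \<A> r))))"
| internal: "s \<notin> query_states \<A> \<Longrightarrow> trans_fun \<A> s = Some s' \<Longrightarrow> move \<A> f s s'"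

text \<open>
  A sequence \<open>s\<^sub>0, \<dots>, s\<^sub>m\<close> is a list of length \<open>m + 1\<close>, so \<open>i < m\<close> is \<^prop>\<open>Suc i < length ss\<close>.
\<close>

definition is_run :: "('s \<Rightarrow> 's \<Rightarrow> bool) \<Rightarrow> 's set \<Rightarrow> 's list \<Rightarrow> bool" where
  "is_run mv E ss \<longleftrightarrow>
     ss \<noteq> [] \<and> (\<forall>i. Suc i < length ss \<longrightarrow> ss ! i \<notin> E \<and> mv (ss ! i) (ss ! Suc i))"

text \<open>The relations \<open>A\<close> and \<open>A'\<close> are the two edge sets of the graph.\<close>

definition control_flow_graph :: "('u, 'x, 'y, 'r) approx_alg \<Rightarrow> (('r, 'y) state \<Rightarrow> 'w) \<Rightarrow>
    'w rel \<Rightarrow> 'w rel \<Rightarrow> bool" where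
  "control_flow_graph \<A> \<pi> A A' \<longleftrightarrow>
     (\<forall>f ss u. is_run (move \<A> f) (end_states \<A>) ss \<longrightarrow> ss ! 0 = State (rho \<A> u) None \<longrightarrow>
        (\<forall>i. Suc i < length ss \<longrightarrow>
           (ss ! i \<notin> query_states \<A> \<longrightarrow> (\<pi> (ss ! i), \<pi> (ss ! Suc i)) \<in> A) \<and>
           (ss ! i \<in> query_states \<A> \<longrightarrow> (\<pi> (ss ! i), \<pi> (ss ! Suc i)) \<in> A')))"


datatype ('r, 'x, 'y) ostate = OState "'r list" "'x list" "nat option" "'y option"

definition init_omega :: "('x list, 'x, 'y, 'r) approx_alg \<Rightarrow> ('r, 'x, 'y) ostate" where
  "init_omega \<A> = OState [rho \<A> []] [] None None"

definition Q1 :: "('x list, 'x, 'y, 'r) approx_alg \<Rightarrow> ('r, 'x, 'y) ostate set" where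
  "Q1 \<A> = {OState (\<sigma> @ [r]) [] None None | \<sigma> r. State r None \<in> query_states \<A>}"

definition Q2 :: "('r, 'x, 'y) ostate set" where
  "Q2 = {OState \<sigma> [] (Some n) None | \<sigma> n. n < length \<sigma>}"

definition end_omega :: "('r, 'x, 'y) ostate set" where
  "end_omega = {OState [] a (Some n) (Some y) | a n y. True}"

text \<open>The sequence \<open>\<xi>\<^sup>*(\<sigma>)::a::\<^bold>0\<close>, where \<open>z\<close> is the distinguished element of \<open>X\<close>.\<close>

definition xi_omega :: "'x \<Rightarrow> ('x list, 'x, 'y, 'r) approx_alg \<Rightarrow> 'r list \<Rightarrow> 'x list \<Rightarrow> nat \<Rightarrow> 'x" where
  "xi_omega z \<A> \<sigma> a =
     (let xs = map (xi \<A>) \<sigma> @ a in (\<lambda>i. if i < length xs then xs ! i else z))"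

text \<open>
  Rule (c) applies only if (a) and (b) do not. For \<open>c_ii\<close> and \<open>c_iii\<close> this is the premise that
  \<open>\<langle>r|y\<rangle>\<close> is not an end state; \<open>c_i\<close> never competes with (a) or (b).
\<close>

inductive trans_omega :: "('x list, 'x, 'y, 'r) approx_alg \<Rightarrow>
    ('r, 'x, 'y) ostate \<Rightarrow> ('r, 'x, 'y) ostate \<Rightarrow> bool"
  for \<A> where
  a: "trans_omega \<A> (OState \<sigma> [] (Some n) None)
        (OState (\<sigma> @ [rho \<A> (map (xi \<A>) \<sigma>)]) [] None None)"
| b: "State r (Some y) \<in> end_states \<A> \<Longrightarrow>
      trans_omega \<A> (OState (\<sigma> @ [r]) a (Some n) (Some y))
        (OState \<sigma> (xi \<A> r # a) (Some n) (Some y))"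
| c_i: "trans_fun \<A> (State r None) = Some (State r' None) \<Longrightarrow>
      trans_omega \<A> (OState (\<sigma> @ [r]) [] None None) (OState (\<sigma> @ [r']) [] None None)"
| c_ii: "State r (Some y) \<notin> end_states \<A> \<Longrightarrow>
      trans_fun \<A> (State r (Some y)) = Some (State r' None) \<Longrightarrow>
      trans_omega \<A> (OState (\<sigma> @ [r]) a (Some n) (Some y)) (OState (\<sigma> @ [r']) [] None None)"
| c_iii: "State r (Some y) \<notin> end_states \<A> \<Longrightarrow>
      trans_fun \<A> (State r (Some y)) = Some (State r' (Some y)) \<Longrightarrow>
      trans_omega \<A> (OState (\<sigma> @ [r]) a (Some n) (Some y))
        (OState (\<sigma> @ [r']) a (Some n) (Some y))"

text \<open>Hence \<open>\<rhd>\<^sub>\<omega>\<close> is a partial function.\<close>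

lemma trans_omega_functional: "trans_omega \<A> s s' \<Longrightarrow> trans_omega \<A> s s'' \<Longrightarrow> s' = s''"
  by (auto elim!: trans_omega.cases)

inductive move_omega :: "'x \<Rightarrow> ('x list, 'x, 'y, 'r) approx_alg \<Rightarrow>
    ((nat \<Rightarrow> 'x) \<Rightarrow> nat) \<Rightarrow> ((nat \<Rightarrow> 'x) \<Rightarrow> 'y) \<Rightarrow>
    ('r, 'x, 'y) ostate \<Rightarrow> ('r, 'x, 'y) ostate \<Rightarrow> bool"
  for z \<A> \<phi>\<^sub>1 \<phi>\<^sub>2 where
  query1: "s \<in> Q1 \<A> \<Longrightarrow> s = OState \<sigma> a o1 o2 \<Longrightarrow>
    move_omega z \<A> \<phi>\<^sub>1 \<phi>\<^sub>2 s (OState \<sigma> a (Some (\<phi>\<^sub>1 (xi_omega z \<A> \<sigma> a))) None)"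
| query2: "s \<in> Q2 \<Longrightarrow> s = OState \<sigma> a (Some n) None \<Longrightarrow>
    move_omega z \<A> \<phi>\<^sub>1 \<phi>\<^sub>2 s (OState \<sigma> a (Some n) (Some (\<phi>\<^sub>2 (xi_omega z \<A> \<sigma> a))))"
| internal: "s \<notin> Q1 \<A> \<union> Q2 \<Longrightarrow> trans_omega \<A> s s' \<Longrightarrow> move_omega z \<A> \<phi>\<^sub>1 \<phi>\<^sub>2 s s'"

definition control_flow_graph_omega :: "'x \<Rightarrow> ('x list, 'x, 'y, 'r) approx_alg \<Rightarrow>
    (('r, 'x, 'y) ostate \<Rightarrow> 'v) \<Rightarrow> 'v rel \<Rightarrow> 'v rel \<Rightarrow> bool" where
  "control_flow_graph_omega z \<A> \<pi>\<^sub>\<omega> B B' \<longleftrightarrow>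
     (\<forall>\<phi>\<^sub>1 \<phi>\<^sub>2 ss. is_run (move_omega z \<A> \<phi>\<^sub>1 \<phi>\<^sub>2) end_omega ss \<longrightarrow> ss ! 0 = init_omega \<A> \<longrightarrow>
        (\<forall>i. Suc i < length ss \<longrightarrow>
           (ss ! i \<notin> Q1 \<A> \<union> Q2 \<longrightarrow> (\<pi>\<^sub>\<omega> (ss ! i), \<pi>\<^sub>\<omega> (ss ! Suc i)) \<in> B) \<and>
           (ss ! i \<in> Q1 \<A> \<union> Q2 \<longrightarrow> (\<pi>\<^sub>\<omega> (ss ! i), \<pi>\<^sub>\<omega> (ss ! Suc i)) \<in> B')))"


datatype tag = Tag_b | Tag_t

datatype 'w vertex = Star | Vertex tag nat 'w

definition Omega_I :: "('x list, 'x, 'y, 'r) approx_alg \<Rightarrow> (('r, 'y) state \<Rightarrow> 'w) \<Rightarrow> 'w set" where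
  "Omega_I \<A> \<pi> = {\<pi> (State (rho \<A> u) None) | u. True}"

definition Omega_E :: "('x list, 'x, 'y, 'r) approx_alg \<Rightarrow> (('r, 'y) state \<Rightarrow> 'w) \<Rightarrow> 'w set" where
  "Omega_E \<A> \<pi> = \<pi> ` end_states \<A>"

inductive_set B_edges :: "'w set \<Rightarrow> 'w set \<Rightarrow> 'w rel \<Rightarrow> 'w rel \<Rightarrow> 'w vertex rel"
  for \<Omega>\<^sub>I \<Omega>\<^sub>E A A' where
  flow: "(p, q) \<in> A \<Longrightarrow> (Vertex Tag_b n p, Vertex Tag_b n q) \<in> B_edges \<Omega>\<^sub>I \<Omega>\<^sub>E A A'"
| call: "(p, q) \<in> A' \<Longrightarrow> u \<in> \<Omega>\<^sub>I \<Longrightarrow>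
    (Vertex Tag_t n p, Vertex Tag_b (n + 1) u) \<in> B_edges \<Omega>\<^sub>I \<Omega>\<^sub>E A A'"
| return: "(p, q) \<in> A' \<Longrightarrow> u \<in> \<Omega>\<^sub>E \<Longrightarrow>
    (Vertex Tag_b (n + 1) u, Vertex Tag_b n q) \<in> B_edges \<Omega>\<^sub>I \<Omega>\<^sub>E A A'"
| finish: "u \<in> \<Omega>\<^sub>E \<Longrightarrow> (Vertex Tag_b 0 u, Star) \<in> B_edges \<Omega>\<^sub>I \<Omega>\<^sub>E A A'"

inductive_set B'_edges :: "'w rel \<Rightarrow> 'w vertex rel"
  for A' where
  query1: "(p, q) \<in> A' \<Longrightarrow> (Vertex Tag_b n p, Vertex Tag_t n p) \<in> B'_edges A'"
| query2: "(p, q) \<in> A' \<Longrightarrow> (Vertex Tag_t n p, Vertex Tag_b n q) \<in> B'_edges A'"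

text \<open>
  A nonempty stack is \<open>\<sigma>::r\<close> with \<open>r = last stk\<close> and \<open>\<sigma> = butlast stk\<close>; the level in the vertex is
  \<open>|\<sigma>|\<close>, one less than the height of the stack.
\<close>

fun pi_omega :: "(('r, 'y) state \<Rightarrow> 'w) \<Rightarrow> ('r, 'x, 'y) ostate \<Rightarrow> 'w vertex" where
  "pi_omega \<pi> (OState stk a o1 o2) =
     (if stk = [] then Star
      else Vertex (if o1 \<noteq> None \<and> o2 = None then Tag_t else Tag_b)
             (length (butlast stk)) (\<pi> (State (last stk) o2)))"

end

(*
  The states that a single stack level of A_omega passes through form a run of A, provided that some
  oracle f : X -> Y gives all the answers received at that level.  Such an oracle exists since the
  answer to a query depends only on the sequence xi*(sigma)::xi(r) below and at the querying level:
  it is either a value of phi_2 or the result of a deterministic recursive evaluation that never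
  looks below its own level except through xi.  The control flow graph of A, applied to these
  levelwise runs, then supplies all the edges of A and A' that the definition of G_omega asks for.
*)
theory Submission
  imports Defs
begin

section \<open>Runs of a single algorithm as reachability\<close>

definition step :: "('u, 'x, 'y, 'r) approx_alg \<Rightarrow> ('x \<Rightarrow> 'y) \<Rightarrow>
    ('r, 'y) state \<Rightarrow> ('r, 'y) state \<Rightarrow> bool" where
  "step \<A> f s s' \<longleftrightarrow> s \<notin> end_states \<A> \<and> move \<A> f s s'"

definition reachable :: "('u, 'x, 'y, 'r) approx_alg \<Rightarrow> ('x \<Rightarrow> 'y) \<Rightarrow> 'u \<Rightarrow> ('r, 'y) state \<Rightarrow> bool"
  where "reachable \<A> f u = (step \<A> f)\<^sup>*\<^sup>* (State (rho \<A> u) None)"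

lemma is_run_snoc:
  assumes "is_run mv E ss" "last ss \<notin> E" "mv (last ss) s"
  shows "is_run mv E (ss @ [s])"
  unfolding is_run_def
proof (intro conjI allI impI)
  fix i
  assume i: "Suc i < length (ss @ [s])"
  have "ss \<noteq> []" using assms(1) by (simp add: is_run_def)
  have "(ss @ [s]) ! i \<notin> E \<and> mv ((ss @ [s]) ! i) ((ss @ [s]) ! Suc i)"
  proof (cases "Suc i < length ss")
    case True
    then show ?thesis using assms(1) by (simp add: is_run_def nth_append)
  next
    case False
    then have "i = length ss - 1" "Suc i = length ss" using i by auto
    then show ?thesis using assms(2,3) \<open>ss \<noteq> []\<close> by (simp add: nth_append last_conv_nth)
  qed
  then show "(ss @ [s]) ! i \<notin> E" "mv ((ss @ [s]) ! i) ((ss @ [s]) ! Suc i)" by blast+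
qed simp

text \<open>Like \<open>is_run\<close>, \<open>step\<close> excludes end states only as sources, so
  a path of steps is a run whose last state may be an end state.\<close>

lemma reachable_run:
  assumes "reachable \<A> f u s"
  obtains ss where "is_run (move \<A> f) (end_states \<A>) ss" "ss ! 0 = State (rho \<A> u) None"
    "last ss = s"
proof -
  have "\<exists>ss. is_run (move \<A> f) (end_states \<A>) ss \<and> ss ! 0 = State (rho \<A> u) None \<and> last ss = s"
    using assms unfolding reachable_def
  proof (induction rule: rtranclp_induct)
    case base
    show ?case by (rule exI[of _ "[State (rho \<A> u) None]"]) (simp add: is_run_def)
  next
    case (step s s')
    then obtain ss where ss: "is_run (move \<A> f) (end_states \<A>) ss"
      "ss ! 0 = State (rho \<A> u) None" "last ss = s" by blast
    moreover have "ss \<noteq> []" using ss(1) by (simp add: is_run_def)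
    ultimately show ?case using step.hyps(2)
      by (intro exI[of _ "ss @ [s']"]) (auto simp: step_def nth_append intro: is_run_snoc)
  qed
  then show thesis using that by blast
qed

text \<open>Appending \<open>s'\<close> to a run that reaches \<open>s\<close> makes the edge in
  question the last one of a run.\<close>

lemma control_flow_graph_step:
  assumes "control_flow_graph \<A> \<pi> A A'" "reachable \<A> f u s" "step \<A> f s s'"
  shows "s \<notin> query_states \<A> \<Longrightarrow> (\<pi> s, \<pi> s') \<in> A"
    and "s \<in> query_states \<A> \<Longrightarrow> (\<pi> s, \<pi> s') \<in> A'"
proof -
  obtain ss where ss: "is_run (move \<A> f) (end_states \<A>) ss" "ss ! 0 = State (rho \<A> u) None"
    "last ss = s"
    using assms(2) by (rule reachable_run)
  have ne: "ss \<noteq> []" using ss(1) by (simp add: is_run_def)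
  have run: "is_run (move \<A> f) (end_states \<A>) (ss @ [s'])"
    using ss assms(3) by (intro is_run_snoc) (auto simp: step_def)
  have eqs: "(ss @ [s']) ! 0 = State (rho \<A> u) None" "(ss @ [s']) ! (length ss - 1) = s"
    "(ss @ [s']) ! Suc (length ss - 1) = s'" "Suc (length ss - 1) < length (ss @ [s'])"
    using ne ss by (auto simp: nth_append last_conv_nth)
  have "(s \<notin> query_states \<A> \<longrightarrow> (\<pi> s, \<pi> s') \<in> A) \<and> (s \<in> query_states \<A> \<longrightarrow> (\<pi> s, \<pi> s') \<in> A')"
    using assms(1) run eqs unfolding control_flow_graph_def by metis
  then show "s \<notin> query_states \<A> \<Longrightarrow> (\<pi> s, \<pi> s') \<in> A"
    "s \<in> query_states \<A> \<Longrightarrow> (\<pi> s, \<pi> s') \<in> A'" by blast+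
qed

lemma reachable_start: "reachable \<A> f u (State (rho \<A> u) None)"
  by (simp add: reachable_def)

lemma reachable_step: "reachable \<A> f u s \<Longrightarrow> step \<A> f s s' \<Longrightarrow> reachable \<A> f u s'"
  by (simp add: reachable_def)

section \<open>Evaluation of queries and the oracle of a level\<close>

definition padded :: "'x \<Rightarrow> 'x list \<Rightarrow> nat \<Rightarrow> 'x" where
  "padded z xs = (\<lambda>i. if i < length xs then xs ! i else z)"

text \<open>The oracles see a stack only through its values under \<open>xi\<close>, so answers can
  be defined on lists over X.\<close>

lemma xi_omega_padded: "xi_omega z \<A> \<sigma> a = padded z (map (xi \<A>) \<sigma> @ a)"
  by (simp add: xi_omega_def padded_def)

locale levels =
  fixes z :: 'x
    and \<A> :: "('x list, 'x, 'y, 'r) approx_alg"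
    and \<phi>\<^sub>1 :: "(nat \<Rightarrow> 'x) \<Rightarrow> nat"
    and \<phi>\<^sub>2 :: "(nat \<Rightarrow> 'x) \<Rightarrow> 'y"
  assumes approx: "approximation_algorithm \<A>"
begin

lemma Some_notin_query_states [simp]: "State r (Some y) \<notin> query_states \<A>"
  using approx by (auto simp: approximation_algorithm_def)

lemma None_notin_end_states [simp]: "State r None \<notin> end_states \<A>"
  using approx by (auto simp: approximation_algorithm_def)

text \<open>\<open>answer ys y\<close>: a query with \<open>\<xi>\<^sup>*(\<sigma>) = ys\<close>, where \<open>\<sigma>\<close> includes the querying level, is answered
  by \<open>y\<close>. \<open>yields xs s y\<close>: a level in state \<open>s\<close> above levels with values \<open>xs\<close> ends with \<open>y\<close>.\<close>

inductive answer :: "'x list \<Rightarrow> 'y \<Rightarrow> bool"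
  and yields :: "'x list \<Rightarrow> ('r, 'y) state \<Rightarrow> 'y \<Rightarrow> bool" where
  direct: "\<phi>\<^sub>1 (padded z ys) < length ys \<Longrightarrow> answer ys (\<phi>\<^sub>2 (padded z ys))"
| recursive: "\<not> \<phi>\<^sub>1 (padded z ys) < length ys \<Longrightarrow> yields ys (State (rho \<A> ys) None) y
    \<Longrightarrow> answer ys y"
| at_end: "State r (Some y) \<in> end_states \<A> \<Longrightarrow> yields xs (State r (Some y)) y"
| internal: "s \<notin> end_states \<A> \<Longrightarrow> s \<notin> query_states \<A> \<Longrightarrow> trans_fun \<A> s = Some s'
    \<Longrightarrow> yields xs s' y \<Longrightarrow> yields xs s y"
| query: "State r None \<in> query_states \<A> \<Longrightarrow> answer (xs @ [xi \<A> r]) y'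
    \<Longrightarrow> yields xs (State r (Some y')) y \<Longrightarrow> yields xs (State r None) y"

text \<open>The side conditions of the rules exclude each other, so a second derivation ends with
  the same rule; the induction hypotheses identify its intermediate answers.\<close>

lemma answer_yields_functional:
  shows "answer ys y \<Longrightarrow> answer ys y2 \<Longrightarrow> y = y2"
    and "yields xs s y \<Longrightarrow> yields xs s y2 \<Longrightarrow> y = y2"
proof (induction arbitrary: y2 and y2 rule: answer_yields.inducts)
  case (direct ys)
  from direct(2,1) show ?case by cases auto
next
  case (recursive ys y)
  from recursive(4,1,3) show ?case by cases auto
next
  case (at_end r y xs)
  from at_end(2,1) show ?case by cases auto
next
  case (internal s s' xs y)
  from internal(6,1,2,3,5) show ?case by cases auto
next
  case (query r xs y' y)
  from query(6,1,3,5) show ?case by cases auto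
qed

text \<open>\<open>THE\<close> makes the oracle total: where evaluation gives no answer its value is
  arbitrary.\<close>

definition oracle_at :: "'x list \<Rightarrow> 'x \<Rightarrow> 'y" where
  "oracle_at xs x = (THE y. answer (xs @ [x]) y)"

lemma oracle_at_eq: "answer (xs @ [x]) y \<Longrightarrow> oracle_at xs x = y"
  unfolding oracle_at_def by (blast intro: the_equality answer_yields_functional(1))

text \<open>The second conjunct keeps track of the past of the level: when it ends with \<open>y\<close>, so did the
  whole evaluation started at \<open>\<rho>(xs)\<close>, and \<open>y\<close> is the answer to the query below.\<close>

definition level :: "'x list \<Rightarrow> ('r, 'y) state \<Rightarrow> bool" where
  "level xs s \<longleftrightarrow> reachable \<A> (oracle_at xs) xs s \<and>
     (\<forall>y. yields xs s y \<longrightarrow> yields xs (State (rho \<A> xs) None) y)"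

lemma level_start: "level xs (State (rho \<A> xs) None)"
  by (simp add: level_def reachable_start)

lemma step_internal:
  "s \<notin> end_states \<A> \<Longrightarrow> s \<notin> query_states \<A> \<Longrightarrow> trans_fun \<A> s = Some s' \<Longrightarrow> step \<A> f s s'"
  by (simp add: step_def move.internal)

lemma step_query: "State r None \<in> query_states \<A> \<Longrightarrow> f (xi \<A> r) = y \<Longrightarrow>
    step \<A> f (State r None) (State r (Some y))"
  by (auto simp: step_def intro: move.query)

text \<open>The rules for \<open>yields\<close> prepend a move: whatever \<open>s'\<close> yields,
  \<open>s\<close> yields too, and hence so does the start of the level.\<close>

lemma level_internal:
  assumes "level xs s" "s \<notin> end_states \<A>" "s \<notin> query_states \<A>" "trans_fun \<A> s = Some s'"
  shows "level xs s'"
  using assms unfolding level_def by (blast intro: reachable_step step_internal internal)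

lemma level_query:
  assumes "level xs (State r None)" "State r None \<in> query_states \<A>" "answer (xs @ [xi \<A> r]) y"
  shows "level xs (State r (Some y))"
  using assms unfolding level_def by (blast intro: reachable_step step_query oracle_at_eq query)

text \<open>The end state yields \<open>y\<close>; the second conjunct of \<open>level\<close>
  transfers this to the initial state, where \<open>recursive\<close> applies.\<close>

lemma answer_of_level:
  assumes "\<not> \<phi>\<^sub>1 (padded z ys) < length ys" "level ys (State r (Some y))"
    "State r (Some y) \<in> end_states \<A>"
  shows "answer ys y"
  using assms unfolding level_def by (blast intro: recursive at_end)

section \<open>The invariant of the combined run\<close>

text \<open>These are the levels below the top, each waiting at a query. The failed comparison with
  \<open>\<phi>\<^sub>1\<close> is recorded because \<open>answer_of_level\<close> needs it when the
  level above ends.\<close>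

inductive suspended :: "'r list \<Rightarrow> bool" where
  Nil: "suspended []"
| snoc: "suspended \<sigma> \<Longrightarrow> level (map (xi \<A>) \<sigma>) (State r None) \<Longrightarrow> State r None \<in> query_states \<A>
    \<Longrightarrow> \<not> \<phi>\<^sub>1 (padded z (map (xi \<A>) (\<sigma> @ [r]))) < length (\<sigma> @ [r]) \<Longrightarrow> suspended (\<sigma> @ [r])"

lemma suspended_snocD:
  assumes "suspended (\<sigma> @ [r])"
  shows "suspended \<sigma>" "level (map (xi \<A>) \<sigma>) (State r None)" "State r None \<in> query_states \<A>"
    "\<not> \<phi>\<^sub>1 (padded z (map (xi \<A>) (\<sigma> @ [r]))) < length (\<sigma> @ [r])"
  using assms by (cases, auto)+

text \<open>In \<open>asked\<close>, \<open>n\<close> is tied to \<open>\<phi>\<^sub>1\<close>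
  because its comparison with the stack height decides between \<open>direct\<close> and
  \<open>recursive\<close>.\<close>

inductive invar :: "('r, 'x, 'y) ostate \<Rightarrow> bool" where
  running: "suspended \<sigma> \<Longrightarrow> level (map (xi \<A>) \<sigma>) (State r None) \<Longrightarrow>
    invar (OState (\<sigma> @ [r]) [] None None)"
| asked: "suspended \<sigma> \<Longrightarrow> level (map (xi \<A>) \<sigma>) (State r None) \<Longrightarrow>
    State r None \<in> query_states \<A> \<Longrightarrow> n = \<phi>\<^sub>1 (padded z (map (xi \<A>) (\<sigma> @ [r]))) \<Longrightarrow>
    invar (OState (\<sigma> @ [r]) [] (Some n) None)"
| answered: "suspended \<sigma> \<Longrightarrow> level (map (xi \<A>) \<sigma>) (State r (Some y)) \<Longrightarrow>
    invar (OState (\<sigma> @ [r]) a (Some n) (Some y))"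
| finished: "invar (OState [] a (Some n) (Some y))"

lemma invar_init: "invar (init_omega \<A>)"
  using running[of "[]" "rho \<A> []"] level_start[of "[]"] suspended.Nil by (simp add: init_omega_def)

lemma control_flow_graph_level:
  assumes cfg: "control_flow_graph \<A> \<pi> A A'" and lev: "level xs s"
  shows "s \<notin> end_states \<A> \<Longrightarrow> s \<notin> query_states \<A> \<Longrightarrow> trans_fun \<A> s = Some s' \<Longrightarrow>
      (\<pi> s, \<pi> s') \<in> A"
    and "s = State r None \<Longrightarrow> s \<in> query_states \<A> \<Longrightarrow> answer (xs @ [xi \<A> r]) y \<Longrightarrow>
      (\<pi> s, \<pi> (State r (Some y))) \<in> A'"
    and "s = State r None \<Longrightarrow> s \<in> query_states \<A> \<Longrightarrow> \<exists>q. (\<pi> s, q) \<in> A'"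
proof -
  note edge = control_flow_graph_step[OF cfg lev[unfolded level_def, THEN conjunct1]]
  show "s \<notin> end_states \<A> \<Longrightarrow> s \<notin> query_states \<A> \<Longrightarrow> trans_fun \<A> s = Some s' \<Longrightarrow>
      (\<pi> s, \<pi> s') \<in> A"
    by (rule edge(1)) (rule step_internal)
  show "s = State r None \<Longrightarrow> s \<in> query_states \<A> \<Longrightarrow> answer (xs @ [xi \<A> r]) y \<Longrightarrow>
      (\<pi> s, \<pi> (State r (Some y))) \<in> A'"
    by (rule edge(2)) (simp_all add: step_query oracle_at_eq)
  \<comment> \<open>The edge must exist before any answer is known, even if none ever comes; the
    total oracle supplies its target.\<close>
  show "s = State r None \<Longrightarrow> s \<in> query_states \<A> \<Longrightarrow> \<exists>q. (\<pi> s, q) \<in> A'"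
    by (rule exI[of _ "\<pi> (State r (Some (oracle_at xs (xi \<A> r))))"], rule edge(2))
      (simp_all add: step_query)
qed

lemma invar_step:
  assumes cfg: "control_flow_graph \<A> \<pi> A A'"
    and "invar s" "s \<notin> end_omega" "move_omega z \<A> \<phi>\<^sub>1 \<phi>\<^sub>2 s s'"
  defines "B \<equiv> B_edges (Omega_I \<A> \<pi>) (Omega_E \<A> \<pi>) A A'"
  shows "invar s' \<and> (s \<notin> Q1 \<A> \<union> Q2 \<longrightarrow> (pi_omega \<pi> s, pi_omega \<pi> s') \<in> B) \<and>
    (s \<in> Q1 \<A> \<union> Q2 \<longrightarrow> (pi_omega \<pi> s, pi_omega \<pi> s') \<in> B'_edges A')"
  using assms(2)
proof cases
  case (running \<sigma> r)
  show ?thesis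
  proof (cases "State r None \<in> query_states \<A>")
    case True
    then have Q: "s \<in> Q1 \<A>" using running by (auto simp: Q1_def)
    have s': "s' = OState (\<sigma> @ [r]) [] (Some (\<phi>\<^sub>1 (padded z (map (xi \<A>) (\<sigma> @ [r]))))) None"
      using assms(4) Q running(1) by cases (auto simp: xi_omega_padded)
    then have "invar s'" using running True by (auto intro: asked simp del: map_append)
    moreover obtain q where "(\<pi> (State r None), q) \<in> A'"
      using control_flow_graph_level(3)[OF cfg running(3) refl True] by blast
    ultimately show ?thesis using Q s' running(1) by (auto intro: B'_edges.query1)
  next
    case False
    then have Q: "s \<notin> Q1 \<A> \<union> Q2" using running by (auto simp: Q1_def Q2_def)
    with assms(4) have "trans_omega \<A> s s'"
      by cases auto
    then obtain r' where t: "trans_fun \<A> (State r None) = Some (State r' None)"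
      and s': "s' = OState (\<sigma> @ [r']) [] None None"
      using running(1) by cases auto
    have "invar s'" unfolding s' using level_internal[OF running(3) _ False t]
      by (intro invar.running running(2)) simp
    moreover have "(\<pi> (State r None), \<pi> (State r' None)) \<in> A"
      using control_flow_graph_level(1)[OF cfg running(3) _ False t] by simp
    ultimately show ?thesis using Q s' running(1) by (auto simp: B_def intro: B_edges.flow)
  qed
next
  case (asked \<sigma> r n)
  show ?thesis
  proof (cases "n < length (\<sigma> @ [r])")
    case True
    then have Q: "s \<in> Q2" using asked by (auto simp: Q2_def)
    define y where "y = \<phi>\<^sub>2 (padded z (map (xi \<A>) (\<sigma> @ [r])))"
    have s': "s' = OState (\<sigma> @ [r]) [] (Some n) (Some y)"
      using assms(4) Q asked(1) by cases (auto simp: xi_omega_padded y_def Q1_def)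
    have ans: "answer (map (xi \<A>) \<sigma> @ [xi \<A> r]) y"
      using direct[of "map (xi \<A>) (\<sigma> @ [r])"] True asked(5) by (simp add: y_def)
    then have "invar s'" unfolding s' using asked by (auto intro: answered level_query)
    moreover have "(\<pi> (State r None), \<pi> (State r (Some y))) \<in> A'"
      using control_flow_graph_level(2)[OF cfg asked(3) refl asked(4) ans] .
    ultimately show ?thesis using Q s' asked(1) by (auto intro: B'_edges.query2)
  next
    case False
    then have Q: "s \<notin> Q1 \<A> \<union> Q2" using asked by (auto simp: Q1_def Q2_def)
    with assms(4) have "trans_omega \<A> s s'"
      by cases auto
    then have s': "s' = OState ((\<sigma> @ [r]) @ [rho \<A> (map (xi \<A>) (\<sigma> @ [r]))]) [] None None"
      using asked(1) by cases auto
    \<comment> \<open>The failed comparison that triggers the call is the last premise of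
      \<open>snoc\<close>.\<close>
    have "suspended (\<sigma> @ [r])" using asked False by (intro snoc) auto
    then have "invar s'" unfolding s' by (intro invar.running level_start)
    moreover obtain q where "(\<pi> (State r None), q) \<in> A'"
      using control_flow_graph_level(3)[OF cfg asked(3) refl asked(4)] by blast
    then have "(Vertex Tag_t (length \<sigma>) (\<pi> (State r None)),
        Vertex Tag_b (length \<sigma> + 1) (\<pi> (State (rho \<A> (map (xi \<A>) (\<sigma> @ [r]))) None))) \<in> B"
      unfolding B_def by (rule B_edges.call) (auto simp: Omega_I_def)
    ultimately show ?thesis using Q s' asked(1) by simp
  qed
next
  case (answered \<sigma> r y a n)
  then have Q: "s \<notin> Q1 \<A> \<union> Q2" by (auto simp: Q1_def Q2_def)
  with assms(4) have "trans_omega \<A> s s'"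
    by cases auto
  then show ?thesis
  proof cases
    case b
    then have E: "State r (Some y) \<in> end_states \<A>"
      and s': "s' = OState \<sigma> (xi \<A> r # a) (Some n) (Some y)"
      using answered(1) by auto
    from E have u: "\<pi> (State r (Some y)) \<in> Omega_E \<A> \<pi>" by (auto simp: Omega_E_def)
    show ?thesis
    \<comment> \<open>Ending the bottom level leads to \<open>Star\<close>; any other end hands
      \<open>y\<close> to the suspended level below.\<close>
    proof (cases \<sigma> rule: rev_cases)
      case Nil
      then show ?thesis using Q s' answered(1) u
        by (auto simp: B_def intro: finished B_edges.finish)
    next
      case (snoc \<tau> q)
      note susp = suspended_snocD[OF answered(2)[unfolded snoc]]
      \<comment> \<open>The ended level was started on the values of the stack up to
        \<open>q\<close>, so its result is the answer to the query of \<open>q\<close>.\<close>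
      have ans: "answer (map (xi \<A>) \<tau> @ [xi \<A> q]) y"
        using answer_of_level[OF _ answered(3) E] susp(4) snoc by simp
      have "invar s'" unfolding s' snoc
        using susp ans by (auto intro: invar.answered level_query)
      moreover have "(\<pi> (State q None), \<pi> (State q (Some y))) \<in> A'"
        using control_flow_graph_level(2)[OF cfg susp(2) refl susp(3) ans] .
      then have "(Vertex Tag_b (length \<tau> + 1) (\<pi> (State r (Some y))),
          Vertex Tag_b (length \<tau>) (\<pi> (State q (Some y)))) \<in> B"
        unfolding B_def using u by (rule B_edges.return)
      ultimately show ?thesis using Q s' answered(1) snoc by simp
    qed
  next
    case (c_ii _ _ r')
    then have t: "State r (Some y) \<notin> end_states \<A>"
        "trans_fun \<A> (State r (Some y)) = Some (State r' None)"
      and s': "s' = OState (\<sigma> @ [r']) [] None None"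
      using answered(1) by auto
    have "invar s'" unfolding s' using level_internal[OF answered(3) t(1) _ t(2)]
      by (intro running answered(2)) simp
    moreover have "(\<pi> (State r (Some y)), \<pi> (State r' None)) \<in> A"
      using control_flow_graph_level(1)[OF cfg answered(3) t(1) _ t(2)] by simp
    ultimately show ?thesis using Q s' answered(1) by (auto simp: B_def intro: B_edges.flow)
  next
    case (c_iii _ _ r')
    then have t: "State r (Some y) \<notin> end_states \<A>"
        "trans_fun \<A> (State r (Some y)) = Some (State r' (Some y))"
      and s': "s' = OState (\<sigma> @ [r']) a (Some n) (Some y)"
      using answered(1) by auto
    have "invar s'" unfolding s' using level_internal[OF answered(3) t(1) _ t(2)]
      by (intro invar.answered answered(2)) simp
    moreover have "(\<pi> (State r (Some y)), \<pi> (State r' (Some y))) \<in> A"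
      using control_flow_graph_level(1)[OF cfg answered(3) t(1) _ t(2)] by simp
    ultimately show ?thesis using Q s' answered(1) by (auto simp: B_def intro: B_edges.flow)
  qed (use answered(1) in auto)
next
  case finished
  then show ?thesis using assms(3) by (auto simp: end_omega_def)
qed

end

theorem theorem5p14:
  fixes z :: 'x
    and \<A> :: "('x list, 'x, 'y, 'r) approx_alg"
    and \<pi> :: "('r, 'y) state \<Rightarrow> 'w"
    and A A' :: "'w rel"
  assumes "approximation_algorithm \<A>"
    and "control_flow_graph \<A> \<pi> A A'"
  shows "control_flow_graph_omega z \<A> (pi_omega \<pi>)
    (B_edges (Omega_I \<A> \<pi>) (Omega_E \<A> \<pi>) A A') (B'_edges A')"
  unfolding control_flow_graph_omega_def
proof (intro allI impI)
  fix \<phi>\<^sub>1 \<phi>\<^sub>2 ss i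
  assume run: "is_run (move_omega z \<A> \<phi>\<^sub>1 \<phi>\<^sub>2) end_omega ss" and start: "ss ! 0 = init_omega \<A>"
    and i: "Suc i < length ss"
  \<comment> \<open>The level oracles depend on the oracles of this run.\<close>
  interpret levels z \<A> \<phi>\<^sub>1 \<phi>\<^sub>2 by unfold_locales (rule assms(1))
  have move: "ss ! j \<notin> end_omega" "move_omega z \<A> \<phi>\<^sub>1 \<phi>\<^sub>2 (ss ! j) (ss ! Suc j)"
    if "Suc j < length ss" for j
    using run that by (auto simp: is_run_def)
  have "invar (ss ! j)" if "j < length ss" for j
    using that
  proof (induction j)
    case 0
    show ?case using start invar_init by simp
  next
    case (Suc j)
    then show ?case using invar_step[OF assms(2) _ move] by simp
  qed
  then show "(ss ! i \<notin> Q1 \<A> \<union> Q2 \<longrightarrow> (pi_omega \<pi> (ss ! i), pi_omega \<pi> (ss ! Suc i))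
        \<in> B_edges (Omega_I \<A> \<pi>) (Omega_E \<A> \<pi>) A A') \<and>
      (ss ! i \<in> Q1 \<A> \<union> Q2 \<longrightarrow> (pi_omega \<pi> (ss ! i), pi_omega \<pi> (ss ! Suc i)) \<in> B'_edges A')"
    using invar_step[OF assms(2) _ move[OF i]] i by simp
qed

end
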